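(* Let $D$ be a digraph on vertex set $V=\{1,\dots,n\}$ and let $p \ge 1$ be an integer. For every integer $q \ge 3$, $$\max \{ \operatorname{ima}(f^p): f \in F[D, q] \} = \max \{ \operatorname{ima}(f^p): f \in F(D, q) \} = \alpha_p(D).$$ Moreover, for $q=2$, $$\max \{ \operatorname{ima}(f^p): f \in F(D, 2) \} = \alpha_p(D).$$
   Context: A digraph $D=(V,E)$ has $V=\{1,\dots,n\}$ and $E\subseteq V^2$ (loops allowed, no repeated arcs). A walk of length $p$ ($p$-walk) is a sequence $(v_0,\dots,v_p)$ of vertices with $(v_s,v_{s+1})\in E$ for $0\le s\le p-1$. Two $p$-walks $(w_0,\dots,w_p)$, $(w'_0,\dots,w'_p)$ are independent if $w_s\ne w'_s$ for all $0\le s\le p$. $\alpha_p(D)$ is the maximum number of pairwise independent $p$-walks in $D$. Let $[q]=\{0,1,\dots,q-1\}$. For $f=(f_1,\dots,f_n):[q]^n\to[q]^n$, the interaction graph $\mathrm{IG}(f)$ is the digraph on $V$ with $(u,v)$ an arc iff $f_v$ depends essentially on $x_u$ (there exist $x,y\in[q]^n$ differing only in coordinate $u$ with $f_v(x)\ne f_v(y)$). $F[D,q]=\{f:[q]^n\to[q]^n : \mathrm{IG}(f)=D\}$ and $F(D,q)=\{f:[q]^n\to[q]^n : \mathrm{IG}(f)\subseteq D\}$. $f^1=f$, $f^{k+1}=f\circ f^k$. For a map $g$ with codomain $[q]^m$, $\operatorname{ima}(g)=\log_q|\mathrm{Im}(g)|$. *)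

theory Defs
  imports
    Complex_Main
    "HOL-Library.FuncSet"
    "Graph_Theory.Pair_Digraph"
    "Graph_Theory.Digraph_Component"
    "Graph_Theory.Vertex_Walk"
begin

text \<open>
  Digraphs with loops but without repeated arcs are the \<^typ>\<open>'a pair_pre_digraph\<close> records
  satisfying \<^locale>\<open>pair_wf_digraph\<close>.
\<close>

definition p_walks :: "'a pair_pre_digraph \<Rightarrow> nat \<Rightarrow> 'a vwalk set" where
  "p_walks D p = {w. vwalk w (with_proj D) \<and> vwalk_length w = p}"

text \<open>\<^term>\<open>vwalk_length\<close> counts arcs, so a \<open>p\<close>-walk is a list of \<open>p + 1\<close> vertices.\<close>

definition independent_walks :: "nat \<Rightarrow> 'a vwalk \<Rightarrow> 'a vwalk \<Rightarrow> bool" where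
  "independent_walks p w w' \<longleftrightarrow> (\<forall>s\<le>p. w ! s \<noteq> w' ! s)"

definition alpha :: "nat \<Rightarrow> 'a pair_pre_digraph \<Rightarrow> nat" where
  "alpha p D = Max {card W | W. W \<subseteq> p_walks D p \<and> pairwise (independent_walks p) W}"

text \<open>
  The configurations \<open>[q]\<^sup>V\<close>, and the self-maps of \<open>[q]\<^sup>V\<close>. Both are extensional
  function spaces, so that their elements correspond exactly to the mathematical objects
  and both sets are finite whenever \<open>V\<close> is.
\<close>

definition configs :: "'a set \<Rightarrow> nat \<Rightarrow> ('a \<Rightarrow> nat) set" where
  "configs V q = V \<rightarrow>\<^sub>E {0..<q}"

definition networks :: "'a set \<Rightarrow> nat \<Rightarrow> (('a \<Rightarrow> nat) \<Rightarrow> ('a \<Rightarrow> nat)) set" where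
  "networks V q = configs V q \<rightarrow>\<^sub>E configs V q"

definition depends_on ::
  "'a set \<Rightarrow> nat \<Rightarrow> (('a \<Rightarrow> nat) \<Rightarrow> ('a \<Rightarrow> nat)) \<Rightarrow> 'a \<Rightarrow> 'a \<Rightarrow> bool" where
  "depends_on V q f v u \<longleftrightarrow>
     (\<exists>x \<in> configs V q. \<exists>y \<in> configs V q.
        x u \<noteq> y u \<and> (\<forall>w \<in> V - {u}. x w = y w) \<and> f x v \<noteq> f y v)"

definition IG ::
  "'a set \<Rightarrow> nat \<Rightarrow> (('a \<Rightarrow> nat) \<Rightarrow> ('a \<Rightarrow> nat)) \<Rightarrow> 'a pair_pre_digraph" where
  "IG V q f = \<lparr> pverts = V, parcs = {(u, v). u \<in> V \<and> v \<in> V \<and> depends_on V q f v u} \<rparr>"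

text \<open>\<open>F_exact D q\<close> and \<open>F_sub D q\<close> are written \<open>F[D, q]\<close> and \<open>F(D, q)\<close> in the literature.\<close>

definition F_exact ::
  "'a pair_pre_digraph \<Rightarrow> nat \<Rightarrow> (('a \<Rightarrow> nat) \<Rightarrow> ('a \<Rightarrow> nat)) set" where
  "F_exact D q = {f \<in> networks (pverts D) q. IG (pverts D) q f = D}"

definition F_sub ::
  "'a pair_pre_digraph \<Rightarrow> nat \<Rightarrow> (('a \<Rightarrow> nat) \<Rightarrow> ('a \<Rightarrow> nat)) set" where
  "F_sub D q =
     {f \<in> networks (pverts D) q. subgraph (with_proj (IG (pverts D) q f)) (with_proj D)}"

definition ima :: "nat \<Rightarrow> 'b set \<Rightarrow> ('b \<Rightarrow> 'c) \<Rightarrow> real" where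
  "ima q A g = log (real q) (real (card (g ` A)))"

text \<open>
  All maxima taken below are over finite nonempty sets, so \<^const>\<open>Max\<close> is never applied outside
  its domain.
\<close>

lemma finite_p_walks: "finite (pverts D) \<Longrightarrow> finite (p_walks D p)"
proof (rule finite_subset)
  show "p_walks D p \<subseteq> {w. set w \<subseteq> pverts D \<and> length w = Suc p}"
    by (auto simp: p_walks_def vwalk_def neq_Nil_conv)
qed (rule finite_lists_length_eq)

lemma alpha_set_finite_nonempty:
  assumes "finite (pverts D)"
  shows "finite {card W | W. W \<subseteq> p_walks D p \<and> pairwise (independent_walks p) W}"
    and "{card W | W. W \<subseteq> p_walks D p \<and> pairwise (independent_walks p) W} \<noteq> {}"
proof -
  have "{card W | W. W \<subseteq> p_walks D p \<and> pairwise (independent_walks p) W}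
      \<subseteq> card ` Pow (p_walks D p)" by auto
  then show "finite {card W | W. W \<subseteq> p_walks D p \<and> pairwise (independent_walks p) W}"
    using finite_p_walks[OF assms] by (meson finite_Pow_iff finite_imageI finite_subset)
  have "{} \<subseteq> p_walks D p \<and> pairwise (independent_walks p) {}" by simp
  then show "{card W | W. W \<subseteq> p_walks D p \<and> pairwise (independent_walks p) W} \<noteq> {}"
    by blast
qed

lemma finite_networks: "finite V \<Longrightarrow> finite (networks V q)"
  by (simp add: networks_def configs_def finite_PiE)

lemma finite_F_exact: "finite (pverts D) \<Longrightarrow> finite (F_exact D q)"
  by (simp add: F_exact_def finite_networks)

lemma finite_F_sub: "finite (pverts D) \<Longrightarrow> finite (F_sub D q)"
  by (simp add: F_sub_def finite_networks)

lemma F_exact_subset_F_sub: "pair_wf_digraph D \<Longrightarrow> F_exact D q \<subseteq> F_sub D q"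
  by (auto simp: F_exact_def F_sub_def subgraph_def compatible_def wf_digraph_wp_iff)

lemma F_exact_nonempty:
  assumes D: "pair_wf_digraph D" and q: "q \<ge> 2"
  shows "F_exact D q \<noteq> {}"
proof -
  define V where "V = pverts D"
  define f :: "('a \<Rightarrow> nat) \<Rightarrow> ('a \<Rightarrow> nat)" where
    "f = restrict (\<lambda>x. restrict (\<lambda>v. if \<exists>u. (u, v) \<in> parcs D \<and> x u \<noteq> 0 then 1 else 0) V)
           (configs V q)"
  have f: "f \<in> networks V q"
    using q by (auto simp: f_def networks_def configs_def)
  have fx: "f x v = (if \<exists>u. (u, v) \<in> parcs D \<and> x u \<noteq> 0 then 1 else 0)"
    if "x \<in> configs V q" "v \<in> V" for x v
    using that by (simp add: f_def)
  have inV: "u \<in> V" "v \<in> V" if "(u, v) \<in> parcs D" for u v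
    using that pair_wf_digraph.in_arcsD1[OF D] pair_wf_digraph.in_arcsD2[OF D]
    by (auto simp: V_def)
  have "depends_on V q f v u" if uv: "(u, v) \<in> parcs D" for u v
  proof -
    define x where "x = restrict (\<lambda>_. 0::nat) V"
    define y where "y = restrict (\<lambda>w. if w = u then 1 else 0::nat) V"
    have xy: "x \<in> configs V q" "y \<in> configs V q"
      using q by (auto simp: x_def y_def configs_def)
    have "f x v = 0"
      using fx[OF xy(1) inV(2)[OF uv]] inV(1) by (simp add: x_def cong: conj_cong)
    moreover have "y u \<noteq> 0" using inV(1)[OF uv] by (simp add: y_def)
    then have "f y v = 1"
      using fx[OF xy(2) inV(2)[OF uv]] uv by auto
    ultimately have "x u \<noteq> y u \<and> (\<forall>w \<in> V - {u}. x w = y w) \<and> f x v \<noteq> f y v"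
      using inV(1)[OF uv] by (auto simp: x_def y_def)
    with xy show ?thesis unfolding depends_on_def by blast
  qed
  moreover have "(u, v) \<in> parcs D" if "u \<in> V" "v \<in> V" "depends_on V q f v u" for u v
  proof (rule ccontr)
    assume no: "(u, v) \<notin> parcs D"
    obtain x y where xy: "x \<in> configs V q" "y \<in> configs V q" "\<forall>w \<in> V - {u}. x w = y w"
      and ne: "f x v \<noteq> f y v"
      using \<open>depends_on V q f v u\<close> unfolding depends_on_def by blast
    have "(w, v) \<in> parcs D \<and> x w \<noteq> 0 \<longleftrightarrow> (w, v) \<in> parcs D \<and> y w \<noteq> 0" for w
      using no xy(3) inV(1)[of w v] by (cases "w = u") auto
    then have "f x v = f y v"
      using fx[OF xy(1) \<open>v \<in> V\<close>] fx[OF xy(2) \<open>v \<in> V\<close>] by simp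
    with ne show False by simp
  qed
  ultimately have "{(u, v). u \<in> V \<and> v \<in> V \<and> depends_on V q f v u} = parcs D"
    using inV by blast
  then have "IG V q f = D"
    by (simp add: IG_def V_def)
  with f show ?thesis unfolding F_exact_def V_def by blast
qed

end

theory Submission
  imports Defs "HOL-Combinatorics.Cycles"
begin

text \<open>
  A subgraph of \<open>D\<close> consisting of disjoint cycles and paths carries as many independent \<open>p\<close>-walks
  as it has vertices that can be followed along it for \<open>p\<close> steps. Finding the best one is an
  assignment problem, whose dual prices \<open>A\<close>, \<open>B\<close> say that deleting each vertex \<open>v\<close> during the
  times \<open>[B v, A v]\<close> destroys all \<open>p\<close>-walks; by complementary slackness this cut is no larger than
  the number of walks carried by the optimal subgraph, so both equal \<open>\<alpha>\<^sub>p(D)\<close>. The cut bounds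
  \<open>|Im(f\<^sup>p)|\<close> from above, since the states of its vertices at those times determine \<open>f\<^sup>p(x)\<close>.
  Copying states along the optimal subgraph attains the bound, and for \<open>q \<ge> 3\<close> the copying can be
  perturbed invertibly so as to depend on every in-neighbour.
\<close>

section \<open>Assignment duality\<close>

fun walk_weight :: "('a \<Rightarrow> 'a \<Rightarrow> int) \<Rightarrow> 'a list \<Rightarrow> int" where
  "walk_weight d (x # y # xs) = d x y + walk_weight d (y # xs)"
| "walk_weight d xs = 0"

lemma walk_weight_append:
  "walk_weight d (xs @ y # ys) = walk_weight d (xs @ [y]) + walk_weight d (y # ys)"
proof (induction xs)
  case (Cons a xs)
  then show ?case by (cases xs) auto
qed simp

lemma walk_weight_snoc:
  "walk_weight d (x # xs @ [y]) = sum_list (map2 d (x # xs) (xs @ [y]))"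
  by (induction xs arbitrary: x) auto

lemma sum_list_map2_map:
  "sum_list (map2 d xs (map g xs)) = (\<Sum>x\<leftarrow>xs. d x (g x))"
  by (induction xs) auto

text \<open>A closed walk without repeated vertices is a cyclic permutation, padded with fixed
  points of weight 0. Any other closed walk splits at a repeated vertex into two shorter ones whose
  weights add up.\<close>

lemma closed_walk_weight_nonpos:
  assumes fin: "finite V"
    and perm: "\<And>\<rho>. \<rho> permutes V \<Longrightarrow> (\<Sum>u\<in>V. d u (\<rho> u)) \<le> 0"
    and refl: "\<And>u. u \<in> V \<Longrightarrow> d u u = 0"
    and "cs \<noteq> []" "set cs \<subseteq> V"
  shows "walk_weight d (cs @ [hd cs]) \<le> 0"
  using assms(4,5)
proof (induction "length cs" arbitrary: cs rule: less_induct)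
  case less
  show ?case
  proof (cases "distinct cs")
    case True
    let ?\<rho> = "cycle_of_list cs"
    obtain x xs where cs: "cs = x # xs" using less.prems(1) by (cases cs) auto
    have rot: "map ?\<rho> cs = rotate1 cs"
      using cyclic_rotation[OF True, of 1] by simp
    have "walk_weight d (cs @ [hd cs]) = sum_list (map2 d cs (rotate1 cs))"
      using walk_weight_snoc[of d x xs x] by (simp add: cs)
    also have "\<dots> = sum_list (map (\<lambda>u. d u (?\<rho> u)) cs)"
      unfolding rot[symmetric] by (rule sum_list_map2_map)
    also have "\<dots> = (\<Sum>u\<in>set cs. d u (?\<rho> u))"
      by (rule sum_list_distinct_conv_sum_set[OF True])
    also have "\<dots> = (\<Sum>u\<in>V. d u (?\<rho> u))"
      using fin less.prems(2) refl by (intro sum.mono_neutral_left) (auto simp: id_outside_supp)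
    also have "\<dots> \<le> 0"
      by (rule perm[OF permutes_subset[OF cycle_permutes less.prems(2)]])
    finally show ?thesis .
  next
    case False
    then obtain as y bs es where cs: "cs = as @ [y] @ bs @ [y] @ es"
      using not_distinct_decomp by blast
    have "walk_weight d (cs @ [hd cs])
        = walk_weight d ((y # bs) @ [hd (y # bs)])
          + walk_weight d ((as @ y # es) @ [hd (as @ y # es)])"
      using walk_weight_append[of d as y "bs @ y # es @ [hd cs]"]
        walk_weight_append[of d "y # bs" y "es @ [hd cs]"]
        walk_weight_append[of d as y "es @ [hd cs]"]
      by (cases as) (simp_all add: cs)
    moreover have "walk_weight d ((y # bs) @ [hd (y # bs)]) \<le> 0"
      using less.prems(2) by (intro less.hyps) (auto simp: cs)
    moreover have "walk_weight d ((as @ y # es) @ [hd (as @ y # es)]) \<le> 0"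
      using less.prems(2) by (intro less.hyps) (auto simp: cs)
    ultimately show ?thesis by linarith
  qed
qed

text \<open>The supremum of the weights of walks from a root to \<open>v\<close> serves as
  \<open>B v\<close>: appending \<open>v\<close> to a walk ending in \<open>u\<close> gives the
  inequality. It is finite because closing such a walk by the step back to the root gives total
  weight at most 0.\<close>

lemma potential_exists:
  fixes d :: "'a \<Rightarrow> 'a \<Rightarrow> int"
  assumes fin: "finite V"
    and perm: "\<And>\<rho>. \<rho> permutes V \<Longrightarrow> (\<Sum>u\<in>V. d u (\<rho> u)) \<le> 0"
    and refl: "\<And>u. u \<in> V \<Longrightarrow> d u u = 0"
  obtains B where "\<And>u v. u \<in> V \<Longrightarrow> v \<in> V \<Longrightarrow> B u + d u v \<le> B v"
proof (cases "V = {}")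
  case False
  then obtain r where r: "r \<in> V" by blast
  define W where "W v = {walk_weight d (r # xs @ [v]) | xs. set xs \<subseteq> V}" for v
  have bdd: "bdd_above (W v)" if "v \<in> V" for v
  proof (rule bdd_aboveI)
    fix z assume "z \<in> W v"
    then obtain xs where z: "z = walk_weight d (r # xs @ [v])" "set xs \<subseteq> V"
      by (auto simp: W_def)
    have "walk_weight d ((r # xs @ [v]) @ [hd (r # xs @ [v])]) \<le> 0"
      using z(2) r that
      by (intro closed_walk_weight_nonpos[where V = V] fin perm refl) auto
    then show "z \<le> - d v r"
      using walk_weight_append[of d "r # xs" v "[r]"] by (simp add: z)
  qed
  have ne: "W v \<noteq> {}" for v
  proof -
    have "walk_weight d (r # [] @ [v]) \<in> W v" unfolding W_def by fastforce
    then show ?thesis by blast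
  qed
  have "Sup (W u) + d u v \<le> Sup (W v)" if "u \<in> V" "v \<in> V" for u v
  proof -
    have "Sup (W u) \<le> Sup (W v) - d u v"
    proof (rule cSup_least[OF ne])
      fix z assume "z \<in> W u"
      then obtain xs where z: "z = walk_weight d (r # xs @ [u])" "set xs \<subseteq> V"
        by (auto simp: W_def)
      have "z + d u v = walk_weight d (r # (xs @ [u]) @ [v])"
        using walk_weight_append[of d "r # xs" u "[v]"] by (simp add: z)
      also have "\<dots> \<in> W v"
        unfolding W_def using z(2) that by (intro CollectI exI[of _ "xs @ [u]"]) auto
      finally show "z \<le> Sup (W v) - d u v"
        using cSup_upper[OF _ bdd[OF \<open>v \<in> V\<close>]] by (simp add: algebra_simps)
    qed
    then show ?thesis by simp
  qed
  then show thesis by (rule that)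
next
  case True
  then show thesis by (intro that[of "\<lambda>_. 0"]) simp
qed

text \<open>Egervary's theorem. For a permutation \<open>\<sigma>\<close> of maximum weight the prices \<open>B\<close> are
  potentials for \<open>d u v = w u (\<sigma> v) - w v (\<sigma> v)\<close>, the gain of rerouting \<open>u\<close> to the partner of \<open>v\<close>.\<close>

theorem assignment_duality:
  fixes w :: "'a \<Rightarrow> 'a \<Rightarrow> int"
  assumes fin: "finite V"
  obtains \<sigma> A B where "\<sigma> permutes V"
    and "\<And>u v. u \<in> V \<Longrightarrow> v \<in> V \<Longrightarrow> B u + w u v \<le> A v"
    and "\<And>u. u \<in> V \<Longrightarrow> A (\<sigma> u) = B u + w u (\<sigma> u)"
proof -
  define T where "T \<sigma> = (\<Sum>u\<in>V. w u (\<sigma> u))" for \<sigma>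
  have "finite (T ` {\<sigma>. \<sigma> permutes V})" "T ` {\<sigma>. \<sigma> permutes V} \<noteq> {}"
    using finite_permutations[OF fin] permutes_id by blast+
  from Max_in[OF this] obtain \<sigma> where \<sigma>: "\<sigma> permutes V" "T \<sigma> = Max (T ` {\<sigma>. \<sigma> permutes V})"
    by auto
  have opt: "T \<tau> \<le> T \<sigma>" if "\<tau> permutes V" for \<tau>
    unfolding \<sigma>(2) using that finite_permutations[OF fin] by (intro Max_ge) auto
  \<comment> \<open>The sum is the gain \<open>T (\<sigma> \<circ> \<rho>) - T \<sigma>\<close>,
    nonpositive because \<open>\<sigma>\<close> is optimal.\<close>
  have "(\<Sum>u\<in>V. w u (\<sigma> (\<rho> u)) - w (\<rho> u) (\<sigma> (\<rho> u))) \<le> 0" if "\<rho> permutes V" for \<rho>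
  proof -
    have "(\<Sum>u\<in>V. w (\<rho> u) (\<sigma> (\<rho> u))) = T \<sigma>"
      unfolding T_def by (rule sum.permute[OF that, of "\<lambda>u. w u (\<sigma> u)", symmetric, unfolded comp_def])
    then show ?thesis
      using opt[OF permutes_compose[OF that \<sigma>(1)]] by (simp add: T_def sum_subtractf)
  qed
  then obtain B where B: "\<And>u v. u \<in> V \<Longrightarrow> v \<in> V \<Longrightarrow> B u + (w u (\<sigma> v) - w v (\<sigma> v)) \<le> B v"
    by (rule potential_exists[OF fin, of "\<lambda>u v. w u (\<sigma> v) - w v (\<sigma> v)"]) auto
  \<comment> \<open>Chosen so that the price inequality is tight for the pair of
    \<open>inv \<sigma> v\<close> and \<open>v\<close>.\<close>
  define A where "A v = B (inv \<sigma> v) + w (inv \<sigma> v) v" for v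
  show thesis
  proof (rule that[OF \<sigma>(1), of B A])
    fix u v assume "u \<in> V" "v \<in> V"
    then show "B u + w u v \<le> A v"
      using B[of u "inv \<sigma> v"] permutes_in_image[OF permutes_inv[OF \<sigma>(1)]]
      by (simp add: A_def permutes_inverses[OF \<sigma>(1)])
  qed (simp add: A_def permutes_inverses[OF \<sigma>(1)])
qed

section \<open>Independent walks and time cuts\<close>

text \<open>Assignment duality with weight \<open>0\<close> for an arc, \<open>-1\<close> for leaving a vertex idle and \<open>-p\<close>
  for jumping from the end of one path to the start of another. The prices are shifted so that
  \<open>B\<close> has maximum \<open>p\<close>.\<close>

lemma path_cycle_duality:
  fixes E :: "('a \<times> 'a) set"
  assumes fin: "finite V" and p: "p \<ge> 1"
  obtains \<sigma> and A B :: "'a \<Rightarrow> int" where "\<sigma> permutes V"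
    and "\<And>v. v \<in> V \<Longrightarrow> 0 \<le> A v"
    and "\<And>v. v \<in> V \<Longrightarrow> B v \<le> int p"
    and "\<And>v. v \<in> V \<Longrightarrow> B v \<le> A v + 1"
    and "\<And>u v. u \<in> V \<Longrightarrow> v \<in> V \<Longrightarrow> (u, v) \<in> E \<Longrightarrow> B u \<le> A v"
    and "\<And>u. u \<in> V \<Longrightarrow> (u, \<sigma> u) \<in> E \<and> A (\<sigma> u) = B u
           \<or> (u, \<sigma> u) \<notin> E \<and> \<sigma> u = u \<and> A u = B u - 1
           \<or> (u, \<sigma> u) \<notin> E \<and> A (\<sigma> u) = 0 \<and> B u = int p"
proof -
  define w where "w u v = (if (u, v) \<in> E then 0 else if u = v then -1 else - int p)" for u v
  obtain \<sigma> A B where \<sigma>: "\<sigma> permutes V"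
    and feas: "\<And>u v. u \<in> V \<Longrightarrow> v \<in> V \<Longrightarrow> B u + w u v \<le> A v"
    and tight: "\<And>u. u \<in> V \<Longrightarrow> A (\<sigma> u) = B u + w u (\<sigma> u)"
    by (rule assignment_duality[OF fin, of w]) (rule that)
  \<comment> \<open>Adding one constant to both prices preserves feasibility and tightness.
    Afterwards some \<open>B u\<close> equals \<open>p\<close>, and since no weight is below
    \<open>-p\<close>, every \<open>A v\<close> is nonnegative.\<close>
  define c where "c = int p - Max (B ` V)"
  have Bp: "B v + c \<le> int p" if "v \<in> V" for v
    using that fin by (simp add: c_def)
  have A0: "0 \<le> A v + c" if "v \<in> V" for v
  proof -
    have "Max (B ` V) \<in> B ` V" using that fin by (intro Max_in) auto
    then obtain u where "u \<in> V" "B u = Max (B ` V)" by auto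
    then show ?thesis
      using feas[OF _ that, of u] p by (auto simp: c_def w_def split: if_splits)
  qed
  show thesis
  proof (rule that[OF \<sigma>, of "\<lambda>v. A v + c" "\<lambda>v. B v + c"])
    fix u assume u: "u \<in> V"
    then have "\<sigma> u \<in> V" using permutes_in_image[OF \<sigma>] by simp
    \<comment> \<open>A jump satisfies \<open>A (\<sigma> u) = B u - p\<close>, so the bounds
      \<open>A \<ge> 0\<close> and \<open>B \<le> p\<close> are both attained.\<close>
    then show "(u, \<sigma> u) \<in> E \<and> A (\<sigma> u) + c = B u + c
           \<or> (u, \<sigma> u) \<notin> E \<and> \<sigma> u = u \<and> A u + c = B u + c - 1
           \<or> (u, \<sigma> u) \<notin> E \<and> A (\<sigma> u) + c = 0 \<and> B u + c = int p"
      using tight[OF u] Bp[OF u] A0[of "\<sigma> u"] by (auto simp: w_def split: if_splits)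
    show "B u + c \<le> A u + c + 1"
      using feas[OF u u] by (auto simp: w_def split: if_splits)
  next
    fix u v assume "u \<in> V" "v \<in> V" "(u, v) \<in> E"
    then show "B u + c \<le> A v + c"
      using feas[of u v] by (simp add: w_def)
  qed (use A0 Bp in auto)
qed

text \<open>An idle vertex of the optimal assignment has \<open>A v = B v - 1\<close>, hence an
  empty interval of times.\<close>

definition time_cut :: "'a set \<Rightarrow> nat \<Rightarrow> ('a \<Rightarrow> int) \<Rightarrow> ('a \<Rightarrow> int) \<Rightarrow> ('a \<times> nat) set" where
  "time_cut V p A B = {(v, t). v \<in> V \<and> t \<le> p \<and> B v \<le> int t \<and> int t \<le> A v}"

text \<open>Dropping from the cycles of \<open>\<sigma>\<close> the steps that are not arcs leaves
  disjoint paths and cycles; a source still has \<open>p\<close> steps ahead of it there.\<close>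

definition orbit_sources :: "('a \<times> 'a) set \<Rightarrow> 'a set \<Rightarrow> nat \<Rightarrow> ('a \<Rightarrow> 'a) \<Rightarrow> 'a set" where
  "orbit_sources E V p \<sigma> = {u \<in> V. \<forall>k<p. ((\<sigma> ^^ k) u, (\<sigma> ^^ Suc k) u) \<in> E}"

lemma finite_time_cut: "finite V \<Longrightarrow> finite (time_cut V p A B)"
  by (rule finite_subset[of _ "V \<times> {..p}"]) (auto simp: time_cut_def)

lemma finite_orbit_sources: "finite V \<Longrightarrow> finite (orbit_sources E V p \<sigma>)"
  by (simp add: orbit_sources_def)

text \<open>A cut pair \<open>(v, t)\<close> is sent to the vertex from which
  \<open>\<sigma>\<close> reaches \<open>v\<close> in \<open>t\<close> steps. Tightness carries
  \<open>t \<le> A\<close> backward and \<open>B \<le> t\<close> forward along the orbit, ruling out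
  idle vertices and jumps, so that vertex is a source.\<close>

lemma card_time_cut_le:
  assumes fin: "finite V" and \<sigma>: "\<sigma> permutes V"
    and idle: "\<And>v. v \<in> V \<Longrightarrow> B v \<le> A v + 1"
    and tight: "\<And>u. u \<in> V \<Longrightarrow> (u, \<sigma> u) \<in> E \<and> A (\<sigma> u) = B u
           \<or> (u, \<sigma> u) \<notin> E \<and> \<sigma> u = u \<and> A u = B u - 1
           \<or> (u, \<sigma> u) \<notin> E \<and> A (\<sigma> u) = 0 \<and> B u = int p"
  shows "card (time_cut V p A B) \<le> card (orbit_sources E V p \<sigma>)"
proof -
  have inV: "(\<sigma> ^^ k) u \<in> V" if "u \<in> V" for k u
    using that permutes_in_image[OF permutes_funpow[OF \<sigma>]] by blast
  \<comment> \<open>The last premise excludes an idle vertex: a cut pair satisfies its first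
    alternative, and each step back supplies the second. A jump would end at price 0, too small for
    a positive time.\<close>
  have backward: "((\<sigma> ^^ k) u, (\<sigma> ^^ Suc k) u) \<in> E"
    if "u \<in> V" "int t \<le> A ((\<sigma> ^^ t) u)" "k < t"
      "A ((\<sigma> ^^ t) u) \<noteq> B ((\<sigma> ^^ t) u) - 1 \<or> ((\<sigma> ^^ t) u, (\<sigma> ^^ Suc t) u) \<in> E" for u t k
    using that(2-)
  proof (induction t)
    case (Suc t)
    let ?x = "(\<sigma> ^^ t) u"
    have "(?x, \<sigma> ?x) \<in> E \<and> A (\<sigma> ?x) = B ?x"
      using tight[OF inV[OF \<open>u \<in> V\<close>, of t]] Suc.prems by auto
    moreover from this have "int t \<le> A ?x"
      using idle[OF inV[OF \<open>u \<in> V\<close>, of t]] Suc.prems(1) by simp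
    ultimately show ?case
      using Suc.IH Suc.prems(2) by (cases "k = t") auto
  qed simp
  \<comment> \<open>A jump needs \<open>B = p\<close>, which \<open>B \<le> k < p\<close>
    excludes.\<close>
  have forward: "B ((\<sigma> ^^ k) u) \<le> int k
      \<and> (t < k \<longrightarrow> A ((\<sigma> ^^ k) u) < int k \<and> ((\<sigma> ^^ (k - 1)) u, (\<sigma> ^^ k) u) \<in> E)"
    if "u \<in> V" "B ((\<sigma> ^^ t) u) \<le> int t" "A ((\<sigma> ^^ t) u) \<noteq> B ((\<sigma> ^^ t) u) - 1"
      "t \<le> k" "k \<le> p" for u t k
    using that(4,5)
  proof (induction k rule: dec_induct)
    case (step k)
    let ?x = "(\<sigma> ^^ k) u"
    have IH: "B ?x \<le> int k" "t < k \<Longrightarrow> ((\<sigma> ^^ (k - 1)) u, ?x) \<in> E"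
      using step by auto
    \<comment> \<open>By injectivity a fixed point reached after time \<open>t\<close> is its own
      predecessor, so the arc just traversed is a loop at it.\<close>
    have "(?x, \<sigma> ?x) \<in> E" if eq: "\<sigma> ?x = ?x" "A ?x = B ?x - 1"
    proof -
      have "t \<noteq> k" using eq(2) \<open>A ((\<sigma> ^^ t) u) \<noteq> _\<close> by auto
      then have "t < k" using step.hyps by simp
      then have "\<sigma> ((\<sigma> ^^ (k - 1)) u) = ?x"
        by (cases k) auto
      then have "(\<sigma> ^^ (k - 1)) u = ?x"
        using eq(1) permutes_inj[OF \<sigma>] by (metis injD)
      then show ?thesis using IH(2)[OF \<open>t < k\<close>] eq(1) by simp
    qed
    then have "(?x, \<sigma> ?x) \<in> E \<and> A (\<sigma> ?x) = B ?x"
      using tight[OF inV[OF \<open>u \<in> V\<close>, of k]] IH(1) step.prems by auto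
    then show ?case
      using IH(1) idle[OF inV[OF \<open>u \<in> V\<close>, of "Suc k"]] by auto
  qed (use that in simp)
  define g where "g = (\<lambda>(v, t). (inv (\<sigma> ^^ t)) v)"
  have g: "g (v, t) \<in> orbit_sources E V p \<sigma> \<and> v = (\<sigma> ^^ t) (g (v, t))
      \<and> (\<forall>k. t < k \<longrightarrow> k \<le> p \<longrightarrow> A ((\<sigma> ^^ k) (g (v, t))) < int k)"
    if C: "(v, t) \<in> time_cut V p A B" for v t
  proof -
    define u where "u = g (v, t)"
    have v: "v \<in> V" "t \<le> p" "B v \<le> int t" "int t \<le> A v"
      using C by (auto simp: time_cut_def)
    have vu: "v = (\<sigma> ^^ t) u"
      by (simp add: u_def g_def permutes_inverses[OF permutes_funpow[OF \<sigma>]])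
    have u: "u \<in> V"
      using v(1) permutes_in_image[OF permutes_inv[OF permutes_funpow[OF \<sigma>]]]
      by (simp add: u_def g_def)
    have ne: "A ((\<sigma> ^^ t) u) \<noteq> B ((\<sigma> ^^ t) u) - 1"
      using v vu by auto
    have f: "A ((\<sigma> ^^ k) u) < int k \<and> ((\<sigma> ^^ (k - 1)) u, (\<sigma> ^^ k) u) \<in> E"
      if "t < k" "k \<le> p" for k
      using forward[OF u _ ne, of k] that v(3) vu by auto
    have "((\<sigma> ^^ k) u, (\<sigma> ^^ Suc k) u) \<in> E" if "k < p" for k
    proof (cases "k < t")
      case True
      then show ?thesis using backward[OF u, of t k] ne v(4) vu by blast
    next
      case False
      then show ?thesis using f[of "Suc k"] that by simp
    qed
    then show ?thesis
      unfolding u_def[symmetric] using u vu f by (simp add: orbit_sources_def)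
  qed
  have "inj_on g (time_cut V p A B)"
  proof (rule inj_onI)
    fix a b assume ab: "a \<in> time_cut V p A B" "b \<in> time_cut V p A B" "g a = g b"
    obtain v t v' t' where eq: "a = (v, t)" "b = (v', t')" by fastforce
    \<comment> \<open>After a cut time \<open>A\<close> stays below the current time, so one orbit
      cannot meet the cut twice.\<close>
    have "\<not> t < t'" "\<not> t' < t"
      using g[of v t] g[of v' t'] ab by (auto simp: eq time_cut_def)
    then show "a = b" using g[of v t] g[of v' t'] ab by (simp add: eq)
  qed
  moreover have "g ` time_cut V p A B \<subseteq> orbit_sources E V p \<sigma>"
    using g by auto
  ultimately show ?thesis
    using finite_orbit_sources[OF fin] by (rule card_inj_on_le)
qed

lemma in_p_walks_iff:
  "w \<in> p_walks D p \<longleftrightarrow> length w = Suc p \<and> set w \<subseteq> pverts D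
     \<and> (\<forall>i<p. (w ! i, w ! Suc i) \<in> parcs D)"
proof -
  have "set (vwalk_arcs w) \<subseteq> F \<longleftrightarrow> (\<forall>i. Suc i < length w \<longrightarrow> (w ! i, w ! Suc i) \<in> F)" for F
    by (induction w rule: vwalk_arcs.induct) (auto simp: less_Suc_eq_0_disj)
  then show ?thesis
    by (auto simp: p_walks_def vwalk_def Suc_diff_Suc)
qed

text \<open>Every \<open>p\<close>-walk meets the cut, and independent walks cannot share a
  vertex-time pair.\<close>

lemma alpha_le_card_time_cut:
  assumes fin: "finite (pverts D)"
    and A0: "\<And>v. v \<in> pverts D \<Longrightarrow> 0 \<le> A v"
    and Bp: "\<And>v. v \<in> pverts D \<Longrightarrow> B v \<le> int p"
    and arc: "\<And>u v. u \<in> pverts D \<Longrightarrow> v \<in> pverts D \<Longrightarrow> (u, v) \<in> parcs D \<Longrightarrow> B u \<le> A v"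
  shows "alpha p D \<le> card (time_cut (pverts D) p A B)"
proof -
  let ?C = "time_cut (pverts D) p A B"
  have hit: "\<exists>t. (w ! t, t) \<in> ?C" if "w \<in> p_walks D p" for w
  proof -
    have w: "length w = Suc p" "\<And>i. i \<le> p \<Longrightarrow> w ! i \<in> pverts D"
      "\<And>i. i < p \<Longrightarrow> (w ! i, w ! Suc i) \<in> parcs D"
      using that by (auto simp: in_p_walks_iff subset_iff)
    \<comment> \<open>The first time with \<open>B (w ! t) \<le> t\<close>; it exists because
      \<open>B \<le> p\<close> at time \<open>p\<close>. If \<open>t > 0\<close>, the preceding
      vertex has \<open>B \<ge> t\<close> by integrality, and its arc to \<open>w ! t\<close> forces
      \<open>t \<le> A (w ! t)\<close>.\<close>
    define t where "t = (LEAST t. B (w ! t) \<le> int t)"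
    have t: "B (w ! t) \<le> int t" "t \<le> p"
      unfolding t_def using Bp[OF w(2)[of p]] by (auto intro: LeastI Least_le)
    have "int t \<le> A (w ! t)"
    proof (cases t)
      case 0
      then show ?thesis using A0 w(2) by simp
    next
      case (Suc s)
      then have "\<not> B (w ! s) \<le> int s"
        using not_less_Least[of s "\<lambda>t. B (w ! t) \<le> int t"] by (simp add: t_def)
      then show ?thesis
        using arc[OF w(2) w(2) w(3), of s] t(2) Suc by simp
    qed
    then show ?thesis using t w(2) by (auto simp: time_cut_def)
  qed
  have "card W \<le> card ?C" if W: "W \<subseteq> p_walks D p" "pairwise (independent_walks p) W" for W
  proof -
    obtain t where t: "\<And>w. w \<in> W \<Longrightarrow> (w ! t w, t w) \<in> ?C"
      using hit W(1) by (metis subsetD)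
    have "inj_on (\<lambda>w. (w ! t w, t w)) W"
    proof (rule inj_onI, rule ccontr)
      fix w w' assume *: "w \<in> W" "w' \<in> W" "(w ! t w, t w) = (w' ! t w', t w')" "w \<noteq> w'"
      then have "independent_walks p w w'" using W(2) by (auto simp: pairwise_def)
      moreover have "t w \<le> p" using t[OF *(1)] by (simp add: time_cut_def)
      ultimately show False using *(3) by (auto simp: independent_walks_def)
    qed
    then show ?thesis
      using t finite_time_cut[OF fin] by (intro card_inj_on_le[of "\<lambda>w. (w ! t w, t w)"]) auto
  qed
  then show ?thesis
    unfolding alpha_def using alpha_set_finite_nonempty[OF fin, of p] by (subst Max_le_iff) auto
qed

text \<open>The iterates of \<open>\<sigma>\<close> from a source form a \<open>p\<close>-walk, and
  injectivity of each \<open>\<sigma> ^^ k\<close> keeps the walks of distinct sources apart at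
  every time.\<close>

lemma card_orbit_sources_le_alpha:
  assumes fin: "finite (pverts D)" and \<sigma>: "\<sigma> permutes pverts D"
  shows "card (orbit_sources (parcs D) (pverts D) p \<sigma>) \<le> alpha p D"
proof -
  let ?S = "orbit_sources (parcs D) (pverts D) p \<sigma>"
  define walk where "walk u = map (\<lambda>k. (\<sigma> ^^ k) u) [0..<Suc p]" for u
  have nth: "walk u ! k = (\<sigma> ^^ k) u" if "k \<le> p" for u k
    using that by (simp add: walk_def del: upt_Suc)
  have inj: "(\<sigma> ^^ k) u = (\<sigma> ^^ k) u' \<longleftrightarrow> u = u'" for k u u'
    using permutes_inj[OF permutes_funpow[OF \<sigma>]] by (auto dest: injD)
  have "walk ` ?S \<subseteq> p_walks D p"
    using permutes_in_image[OF permutes_funpow[OF \<sigma>]]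
    by (auto simp: in_p_walks_iff nth orbit_sources_def) (auto simp: walk_def)
  moreover have "pairwise (independent_walks p) (walk ` ?S)"
    by (auto simp: pairwise_def independent_walks_def nth inj)
  ultimately have "card (walk ` ?S) \<le> alpha p D"
    unfolding alpha_def using alpha_set_finite_nonempty(1)[OF fin] by (intro Max_ge) auto
  moreover have "inj_on walk ?S"
    using nth[of 0] by (intro inj_onI) (metis funpow_0 le0)
  ultimately show ?thesis by (simp add: card_image)
qed

text \<open>The sources number at most \<open>alpha p D\<close>, which is at most the size of the
  cut, which is at most the number of sources; so all three agree.\<close>

lemma alpha_duality:
  assumes fin: "finite (pverts D)" and p: "p \<ge> 1"
  obtains \<sigma> and A B :: "'a \<Rightarrow> int" where "\<sigma> permutes pverts D"
    and "\<And>v. v \<in> pverts D \<Longrightarrow> 0 \<le> A v"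
    and "\<And>v. v \<in> pverts D \<Longrightarrow> B v \<le> int p"
    and "\<And>u v. u \<in> pverts D \<Longrightarrow> v \<in> pverts D \<Longrightarrow> (u, v) \<in> parcs D \<Longrightarrow> B u \<le> A v"
    and "card (time_cut (pverts D) p A B) = alpha p (D :: 'a pair_pre_digraph)"
    and "card (orbit_sources (parcs D) (pverts D) p \<sigma>) = alpha p D"
proof -
  obtain \<sigma> and A B :: "'a \<Rightarrow> int" where
    *: "\<sigma> permutes pverts D"
      "\<And>v. v \<in> pverts D \<Longrightarrow> 0 \<le> A v"
      "\<And>v. v \<in> pverts D \<Longrightarrow> B v \<le> int p"
      "\<And>v. v \<in> pverts D \<Longrightarrow> B v \<le> A v + 1"
      "\<And>u v. u \<in> pverts D \<Longrightarrow> v \<in> pverts D \<Longrightarrow> (u, v) \<in> parcs D \<Longrightarrow> B u \<le> A v"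
      "\<And>u. u \<in> pverts D \<Longrightarrow> (u, \<sigma> u) \<in> parcs D \<and> A (\<sigma> u) = B u
           \<or> (u, \<sigma> u) \<notin> parcs D \<and> \<sigma> u = u \<and> A u = B u - 1
           \<or> (u, \<sigma> u) \<notin> parcs D \<and> A (\<sigma> u) = 0 \<and> B u = int p"
    by (rule path_cycle_duality[OF fin p, of "parcs D"]) (rule that)
  have "card (time_cut (pverts D) p A B) \<le> card (orbit_sources (parcs D) (pverts D) p \<sigma>)"
    using card_time_cut_le[OF fin *(1,4,6)] .
  moreover have "alpha p D \<le> card (time_cut (pverts D) p A B)"
    using alpha_le_card_time_cut[OF fin *(2,3,5)] .
  moreover have "card (orbit_sources (parcs D) (pverts D) p \<sigma>) \<le> alpha p D"
    using card_orbit_sources_le_alpha[OF fin *(1)] .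
  ultimately show thesis using that[OF *(1,2,3,5)] by simp
qed

section \<open>Images of iterated networks\<close>

lemma finite_configs: "finite V \<Longrightarrow> finite (configs V q)"
  by (simp add: configs_def finite_PiE)

lemma funpow_configs:
  assumes "f \<in> networks V q" "x \<in> configs V q"
  shows "(f ^^ k) x \<in> configs V q"
  using assms by (induction k) (auto simp: networks_def)

text \<open>The interaction graph is always well-formed on the same vertices, so being a subgraph
  only concerns arcs.\<close>

lemma F_sub_iff:
  assumes "pair_wf_digraph D"
  shows "f \<in> F_sub D q \<longleftrightarrow> f \<in> networks (pverts D) q
    \<and> (\<forall>u\<in>pverts D. \<forall>v\<in>pverts D. depends_on (pverts D) q f v u \<longrightarrow> (u, v) \<in> parcs D)"
proof -
  have "wf_digraph (with_proj (IG (pverts D) q f))"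
    by unfold_locales (auto simp: IG_def)
  then show ?thesis
    using assms by (auto simp: F_sub_def subgraph_def compatible_def IG_def wf_digraph_wp_iff)
qed

text \<open>Turn \<open>x\<close> into \<open>y\<close> one coordinate at a time: each changed
  coordinate lies outside \<open>N\<close>, so the value at \<open>v\<close> is preserved.\<close>

lemma network_local:
  assumes fin: "finite V"
    and dep: "\<And>u. u \<in> V \<Longrightarrow> depends_on V q f v u \<Longrightarrow> u \<in> N"
    and x: "x \<in> configs V q" and y: "y \<in> configs V q"
    and agree: "\<And>u. u \<in> N \<Longrightarrow> u \<in> V \<Longrightarrow> x u = y u"
  shows "f x v = f y v"
proof -
  have "finite {u\<in>V. x u \<noteq> y u}" using fin by simp
  then show ?thesis using x agree
  proof (induction "{u\<in>V. x u \<noteq> y u}" arbitrary: x rule: finite_psubset_induct)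
    case (psubset x)
    show ?case
    proof (cases "\<exists>u\<in>V. x u \<noteq> y u")
      case True
      then obtain u where u: "u \<in> V" "x u \<noteq> y u" by blast
      define z where "z = x(u := y u)"
      have z: "z \<in> configs V q"
        using psubset.prems(1) y u(1) by (auto simp: z_def configs_def PiE_iff extensional_def)
      have "f x v = f z v"
      proof (rule ccontr)
        assume "f x v \<noteq> f z v"
        then have "depends_on V q f v u"
          unfolding depends_on_def using psubset.prems(1) z u
          by (intro bexI[of _ x] bexI[of _ z]) (auto simp: z_def)
        then show False using dep u psubset.prems(2) by blast
      qed
      also have "f z v = f y v"
      proof (rule psubset.hyps)
        show "{w \<in> V. z w \<noteq> y w} \<subset> {w \<in> V. x w \<noteq> y w}"
          using u by (auto simp: z_def)
        show "z w = y w" if "w \<in> N" "w \<in> V" for w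
          using psubset.prems(2) that by (simp add: z_def)
      qed (rule z)
      finally show ?thesis .
    next
      case False
      then have "x = y"
        using psubset.prems(1) y unfolding configs_def by (intro PiE_ext) auto
      then show ?thesis by simp
    qed
  qed
qed

text \<open>The values on the time cut determine \<open>(f ^^ t) x v\<close> for all \<open>t \<ge> B v\<close>: if \<open>t > A v\<close>,
  then every in-neighbour \<open>u\<close> has \<open>B u \<le> A v \<le> t - 1\<close>.\<close>

lemma card_image_funpow_le:
  assumes D: "pair_wf_digraph D" and fin: "finite (pverts D)" and f: "f \<in> F_sub D q"
    and A0: "\<And>v. v \<in> pverts D \<Longrightarrow> 0 \<le> A v"
    and Bp: "\<And>v. v \<in> pverts D \<Longrightarrow> B v \<le> int p"
    and arc: "\<And>u v. u \<in> pverts D \<Longrightarrow> v \<in> pverts D \<Longrightarrow> (u, v) \<in> parcs D \<Longrightarrow> B u \<le> A v"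
  shows "card ((f ^^ p) ` configs (pverts D) q) \<le> q ^ card (time_cut (pverts D) p A B)"
proof -
  let ?V = "pverts D" and ?X = "configs (pverts D) q" and ?C = "time_cut (pverts D) p A B"
  have net: "f \<in> networks ?V q"
    and dep: "\<And>u v. u \<in> ?V \<Longrightarrow> v \<in> ?V \<Longrightarrow> depends_on ?V q f v u \<Longrightarrow> (u, v) \<in> parcs D"
    using f F_sub_iff[OF D] by auto
  define obs where "obs x = (\<lambda>(v, t)\<in>?C. (f ^^ t) x v)" for x
  have det: "(f ^^ p) x = (f ^^ p) y" if x: "x \<in> ?X" and y: "y \<in> ?X" and eq: "obs x = obs y" for x y
  proof -
    have obs_eq: "(f ^^ t) x v = (f ^^ t) y v" if "(v, t) \<in> ?C" for v t
      using fun_cong[OF eq, of "(v, t)"] that by (simp add: obs_def)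
    \<comment> \<open>At \<open>t = 0\<close> such a \<open>v\<close> lies in the cut because
      \<open>0 \<le> A v\<close>; at \<open>t = p\<close> every vertex qualifies because
      \<open>B v \<le> p\<close>.\<close>
    have "(f ^^ t) x v = (f ^^ t) y v" if "t \<le> p" "v \<in> ?V" "B v \<le> int t" for t v
      using that
    proof (induction t arbitrary: v)
      case 0
      then show ?case using A0 by (intro obs_eq) (simp add: time_cut_def)
    next
      case (Suc t)
      show ?case
      proof (cases "int (Suc t) \<le> A v")
        case True
        then show ?thesis using Suc.prems by (intro obs_eq) (simp add: time_cut_def)
      next
        case False
        have "f ((f ^^ t) x) v = f ((f ^^ t) y) v"
        proof (rule network_local[OF fin, where N = "{u. (u, v) \<in> parcs D}" and q = q and f = f and v = v])
          show "u \<in> {u. (u, v) \<in> parcs D}" if "u \<in> ?V" "depends_on ?V q f v u" for u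
            using dep that Suc.prems(2) by blast
          show "(f ^^ t) x u = (f ^^ t) y u" if "u \<in> {u. (u, v) \<in> parcs D}" "u \<in> ?V" for u
            using arc[of u v] that False Suc.prems by (intro Suc.IH) auto
        qed (use x y funpow_configs[OF net] in auto)
        then show ?thesis by simp
      qed
    qed
    then show ?thesis
      using funpow_configs[OF net x, of p] funpow_configs[OF net y, of p] Bp
      unfolding configs_def by (intro PiE_ext) auto
  qed
  have "card ((f ^^ p) ` ?X) \<le> card (obs ` ?X)"
  proof (rule surj_card_le)
    show "finite (obs ` ?X)" using finite_configs[OF fin] by simp
    show "(f ^^ p) ` ?X \<subseteq> (\<lambda>z. (f ^^ p) (inv_into ?X obs z)) ` obs ` ?X"
    proof
      fix y assume "y \<in> (f ^^ p) ` ?X"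
      then obtain x where x: "x \<in> ?X" "y = (f ^^ p) x" by blast
      then have "(f ^^ p) (inv_into ?X obs (obs x)) = y"
        using det[of "inv_into ?X obs (obs x)" x]
        by (simp add: inv_into_into f_inv_into_f)
      then show "y \<in> (\<lambda>z. (f ^^ p) (inv_into ?X obs z)) ` obs ` ?X" using x(1) by blast
    qed
  qed
  also have "\<dots> \<le> card (?C \<rightarrow>\<^sub>E {0..<q})"
  proof (rule card_mono)
    show "finite (?C \<rightarrow>\<^sub>E {0..<q})" using finite_time_cut[OF fin] by (simp add: finite_PiE)
    show "obs ` ?X \<subseteq> ?C \<rightarrow>\<^sub>E {0..<q}"
    proof (rule image_subsetI)
      fix x assume "x \<in> ?X"
      then have "(f ^^ t) x v \<in> {0..<q}" if "(v, t) \<in> ?C" for v t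
        using funpow_configs[OF net, of x t] that
        unfolding configs_def time_cut_def by (auto dest: PiE_mem)
      then show "obs x \<in> ?C \<rightarrow>\<^sub>E {0..<q}"
        unfolding obs_def restrict_PiE_iff by (auto simp del: atLeastLessThan_iff)
    qed
  qed
  also have "\<dots> = q ^ card ?C"
    using finite_time_cut[OF fin] by (simp add: card_PiE)
  finally show ?thesis .
qed

section \<open>The copying network and its image\<close>

definition swap01 :: "bool \<Rightarrow> nat \<Rightarrow> nat" where
  "swap01 b a = (if b then Transposition.transpose 0 1 a else a)"

lemma swap01_inject [simp]: "swap01 b a = swap01 b a' \<longleftrightarrow> a = a'"
  by (auto simp: swap01_def transpose_def)

lemma swap01_eq_2_iff [simp]: "swap01 b a = 2 \<longleftrightarrow> a = 2"
  by (auto simp: swap01_def transpose_def)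

lemma swap01_less: "q \<ge> 2 \<Longrightarrow> a < q \<Longrightarrow> swap01 b a < q"
  by (auto simp: swap01_def transpose_def)

text \<open>Vertices copy along \<open>\<sigma>\<close>, exchanging \<open>0\<close> and \<open>1\<close> when another in-neighbour has state \<open>2\<close>.
  The state \<open>2\<close> itself is always copied unchanged, so the exchanges that will occur are determined
  by the initial positions of the \<open>2\<close>s. For \<open>q = 2\<close> no exchange ever happens.\<close>

definition copy_network ::
  "'a pair_pre_digraph \<Rightarrow> nat \<Rightarrow> ('a \<Rightarrow> 'a) \<Rightarrow> ('a \<Rightarrow> nat) \<Rightarrow> ('a \<Rightarrow> nat)" where
  "copy_network D q \<sigma> = (\<lambda>x\<in>configs (pverts D) q. \<lambda>v\<in>pverts D.
     swap01 (\<exists>u. (u, v) \<in> parcs D \<and> u \<noteq> inv \<sigma> v \<and> x u = 2)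
       (if (inv \<sigma> v, v) \<in> parcs D then x (inv \<sigma> v) else 0))"

context
  fixes D :: "'a pair_pre_digraph" and q :: nat and \<sigma> :: "'a \<Rightarrow> 'a"
  assumes D: "pair_wf_digraph D" and fin: "finite (pverts D)" and q: "q \<ge> 2"
    and \<sigma>: "\<sigma> permutes pverts D"
begin

lemma arc_in_verts: "(u, v) \<in> parcs D \<Longrightarrow> u \<in> pverts D" "(u, v) \<in> parcs D \<Longrightarrow> v \<in> pverts D"
  using pair_wf_digraph.in_arcsD1[OF D] pair_wf_digraph.in_arcsD2[OF D] by auto

lemma copy_network_apply:
  assumes "x \<in> configs (pverts D) q" "v \<in> pverts D"
  shows "copy_network D q \<sigma> x v = swap01 (\<exists>u. (u, v) \<in> parcs D \<and> u \<noteq> inv \<sigma> v \<and> x u = 2)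
       (if (inv \<sigma> v, v) \<in> parcs D then x (inv \<sigma> v) else 0)"
  using assms by (simp add: copy_network_def)

lemma copy_network_in_networks: "copy_network D q \<sigma> \<in> networks (pverts D) q"
proof -
  have "x (inv \<sigma> v) < q" if "x \<in> configs (pverts D) q" "v \<in> pverts D" for x v
    using that permutes_in_image[OF permutes_inv[OF \<sigma>]] by (auto simp: configs_def PiE_iff)
  then show ?thesis
    using q by (auto simp: networks_def copy_network_def configs_def PiE_iff intro!: swap01_less)
qed

lemma copy_network_in_F_sub: "copy_network D q \<sigma> \<in> F_sub D q"
proof -
  have "(u, v) \<in> parcs D" if v: "v \<in> pverts D" and dep: "depends_on (pverts D) q (copy_network D q \<sigma>) v u"
    for u v
  proof (rule ccontr)
    assume no: "(u, v) \<notin> parcs D"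
    obtain x y where xy: "x \<in> configs (pverts D) q" "y \<in> configs (pverts D) q"
        "\<forall>w \<in> pverts D - {u}. x w = y w" "copy_network D q \<sigma> x v \<noteq> copy_network D q \<sigma> y v"
      using dep unfolding depends_on_def by blast
    have "x w = y w" if "(w, v) \<in> parcs D" for w
      using xy(3) no arc_in_verts that by (cases "w = u") auto
    then have "copy_network D q \<sigma> x v = copy_network D q \<sigma> y v"
      using xy(1,2) v by (simp add: copy_network_apply cong: conj_cong)
    with xy(4) show False by simp
  qed
  then show ?thesis
    using copy_network_in_networks F_sub_iff[OF D] by blast
qed

text \<open>Compare the zero configuration with the one that raises only \<open>u\<close> to 2, a
  legal state as \<open>q \<ge> 3\<close>. If \<open>u\<close> is the copied vertex,
  \<open>v\<close> changes from 0 to 2; otherwise the exchange turns its 0 into 1.\<close>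

lemma copy_network_in_F_exact:
  assumes q3: "q \<ge> 3"
  shows "copy_network D q \<sigma> \<in> F_exact D q"
proof -
  let ?V = "pverts D"
  have "depends_on ?V q (copy_network D q \<sigma>) v u" if uv: "(u, v) \<in> parcs D" for u v
  proof -
    define x where "x = (\<lambda>w\<in>?V. 0::nat)"
    define y where "y = (\<lambda>w\<in>?V. if w = u then 2 else 0::nat)"
    have xy: "x \<in> configs ?V q" "y \<in> configs ?V q"
      using q3 by (auto simp: x_def y_def configs_def)
    have x0: "x w \<noteq> 2" "x w = 0" "y w = (if w = u then 2 else 0)" if "w \<in> ?V" for w
      using that by (auto simp: x_def y_def)
    have inv: "inv \<sigma> v \<in> ?V"
      using arc_in_verts(2)[OF uv] permutes_in_image[OF permutes_inv[OF \<sigma>]] by simp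
    have "copy_network D q \<sigma> x v = 0"
      using x0(1) arc_in_verts(1) arc_in_verts(2)[OF uv]
      by (auto simp: copy_network_apply xy x0(2)[OF inv] swap01_def)
    moreover have "copy_network D q \<sigma> y v \<noteq> 0"
    proof (cases "u = inv \<sigma> v")
      case True
      then have "copy_network D q \<sigma> y v = 2"
        using uv arc_in_verts[OF uv] by (simp add: copy_network_apply xy x0)
      then show ?thesis by simp
    next
      case False
      then have "\<exists>w. (w, v) \<in> parcs D \<and> w \<noteq> inv \<sigma> v \<and> y w = 2"
        using uv x0(3)[OF arc_in_verts(1)[OF uv]] by auto
      then show ?thesis
        using False arc_in_verts[OF uv] by (auto simp: copy_network_apply xy x0(3)[OF inv] swap01_def)
    qed
    ultimately show ?thesis
      unfolding depends_on_def using xy x0 arc_in_verts(1)[OF uv]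
      by (intro bexI[of _ x] bexI[of _ y]) auto
  qed
  moreover have "(u, v) \<in> parcs D"
    if "u \<in> ?V" "v \<in> ?V" "depends_on ?V q (copy_network D q \<sigma>) v u" for u v
    using that copy_network_in_F_sub F_sub_iff[OF D] by blast
  ultimately have "{(u, v). u \<in> ?V \<and> v \<in> ?V \<and> depends_on ?V q (copy_network D q \<sigma>) v u} = parcs D"
    using arc_in_verts by blast
  then show ?thesis
    using copy_network_in_networks by (simp add: F_exact_def IG_def)
qed

text \<open>States placed on the sources can be recovered after \<open>p\<close> steps: the final 2s
  reveal the initial ones, these fix all exchanges, and the exchanges can be undone.\<close>

lemma card_image_copy_network_ge:
  "q ^ card (orbit_sources (parcs D) (pverts D) p \<sigma>)
     \<le> card ((copy_network D q \<sigma> ^^ p) ` configs (pverts D) q)"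
proof -
  let ?V = "pverts D" and ?X = "configs (pverts D) q" and ?f = "copy_network D q \<sigma>"
  let ?S = "orbit_sources (parcs D) (pverts D) p \<sigma>"
  have inV: "(\<sigma> ^^ k) u \<in> ?V" if "u \<in> ?V" for k u
    using that permutes_in_image[OF permutes_funpow[OF \<sigma>]] by blast
  have onto: "\<exists>u\<in>?V. v = (\<sigma> ^^ k) u" if "v \<in> ?V" for k v
    using that permutes_image[OF permutes_funpow[OF \<sigma>], of k] by blast
  have step: "(?f ^^ Suc k) x (\<sigma> v)
      = swap01 (\<exists>u. (u, \<sigma> v) \<in> parcs D \<and> u \<noteq> v \<and> (?f ^^ k) x u = 2)
          (if (v, \<sigma> v) \<in> parcs D then (?f ^^ k) x v else 0)" if "x \<in> ?X" "v \<in> ?V" for k x v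
    using that inV[of v 1] funpow_configs[OF copy_network_in_networks]
    by (simp add: copy_network_apply permutes_inverses[OF \<sigma>])
  \<comment> \<open>Exchanges neither create nor destroy a 2, and a missing arc inserts the default
    0, so a 2 survives exactly as long as \<open>\<sigma>\<close> follows arcs.\<close>
  have two: "(?f ^^ k) x ((\<sigma> ^^ k) u) = 2
      \<longleftrightarrow> (\<forall>i<k. ((\<sigma> ^^ i) u, (\<sigma> ^^ Suc i) u) \<in> parcs D) \<and> x u = 2"
    if "x \<in> ?X" "u \<in> ?V" for k x u
  proof (induction k)
    case (Suc k)
    let ?v = "(\<sigma> ^^ k) u"
    have "(?f ^^ Suc k) x (\<sigma> ?v) = 2 \<longleftrightarrow> (?v, \<sigma> ?v) \<in> parcs D \<and> (?f ^^ k) x ?v = 2"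
      unfolding step[OF that(1) inV[OF that(2)]] by simp
    then show ?case
      using Suc.IH by (auto simp: less_Suc_eq)
  qed simp
  \<comment> \<open>A constant off the sources makes the initial 2s there identical for all
    \<open>z\<close>.\<close>
  define ext where "ext z = (\<lambda>v\<in>?V. if v \<in> ?S then z v else 0)" for z :: "'a \<Rightarrow> nat"
  have S: "?S \<subseteq> ?V" by (auto simp: orbit_sources_def)
  have ext: "ext z \<in> ?X" if "z \<in> ?S \<rightarrow>\<^sub>E {0..<q}" for z
    using that q by (auto simp: ext_def configs_def PiE_iff)
  have "inj_on (\<lambda>z. (?f ^^ p) (ext z)) (?S \<rightarrow>\<^sub>E {0..<q})"
  proof (rule inj_onI)
    fix z z' assume z: "z \<in> ?S \<rightarrow>\<^sub>E {0..<q}" "z' \<in> ?S \<rightarrow>\<^sub>E {0..<q}"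
      and eq: "(?f ^^ p) (ext z) = (?f ^^ p) (ext z')"
    have start2: "ext z u = 2 \<longleftrightarrow> ext z' u = 2" if "u \<in> ?V" for u
    proof (cases "u \<in> ?S")
      case True
      then have "\<forall>i<p. ((\<sigma> ^^ i) u, (\<sigma> ^^ Suc i) u) \<in> parcs D"
        by (simp add: orbit_sources_def)
      then show ?thesis
        using two[OF ext[OF z(1)] that, of p] two[OF ext[OF z(2)] that, of p] eq by simp
    qed (use that in \<open>simp add: ext_def\<close>)
    have same2: "(?f ^^ k) (ext z) v = 2 \<longleftrightarrow> (?f ^^ k) (ext z') v = 2"
      if v: "v \<in> ?V" for k v
    proof -
      obtain u where "u \<in> ?V" "v = (\<sigma> ^^ k) u" using onto[OF v] by blast
      then show ?thesis
        using two[OF ext[OF z(1)]] two[OF ext[OF z(2)]] start2 by simp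
    qed
    \<comment> \<open>Going back from time \<open>k\<close>, both runs undergo the same exchange by
      \<open>same2\<close>, and it is injective.\<close>
    have cancel: "z u = z' u"
      if "u \<in> ?S" "k \<le> p" "(?f ^^ k) (ext z) ((\<sigma> ^^ k) u) = (?f ^^ k) (ext z') ((\<sigma> ^^ k) u)" for k u
      using that
    proof (induction k)
      case 0
      then show ?case using S by (auto simp: ext_def)
    next
      case (Suc k)
      have u: "u \<in> ?V" using S Suc.prems(1) by blast
      let ?v = "(\<sigma> ^^ k) u"
      have "(?v, \<sigma> ?v) \<in> parcs D"
        using Suc.prems by (simp add: orbit_sources_def)
      moreover have "(\<exists>w. (w, \<sigma> ?v) \<in> parcs D \<and> w \<noteq> ?v \<and> (?f ^^ k) (ext z) w = 2)
          \<longleftrightarrow> (\<exists>w. (w, \<sigma> ?v) \<in> parcs D \<and> w \<noteq> ?v \<and> (?f ^^ k) (ext z') w = 2)"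
        using same2 arc_in_verts(1) by blast
      ultimately have "(?f ^^ k) (ext z) ?v = (?f ^^ k) (ext z') ?v"
        using Suc.prems(3) step[OF ext[OF z(1)] inV[OF u], of k k] step[OF ext[OF z(2)] inV[OF u], of k k]
        by simp
      then show ?case using Suc.IH Suc.prems by simp
    qed
    show "z = z'"
      using z cancel[of _ p] eq by (intro PiE_ext[of z ?S]) auto
  qed
  moreover have "(\<lambda>z. (?f ^^ p) (ext z)) ` (?S \<rightarrow>\<^sub>E {0..<q}) \<subseteq> (?f ^^ p) ` ?X"
    using ext by auto
  moreover have "finite ((?f ^^ p) ` ?X)"
    using finite_configs[OF fin] by simp
  ultimately have "card (?S \<rightarrow>\<^sub>E {0..<q}) \<le> card ((?f ^^ p) ` ?X)"
    by (rule card_inj_on_le)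
  then show ?thesis
    using finite_orbit_sources[OF fin] by (simp add: card_PiE)
qed

end

section \<open>Logarithms and maxima\<close>

lemma ima_le:
  assumes "q \<ge> 2" "card (g ` X) \<le> q ^ k" "finite X" "X \<noteq> {}"
  shows "ima q X g \<le> real k"
proof -
  have "card (g ` X) > 0" using assms(3,4) by (simp add: card_gt_0_iff)
  moreover have "real (card (g ` X)) \<le> real q ^ k"
    using assms(2) by (metis of_nat_le_iff of_nat_power)
  ultimately have "log (real q) (real (card (g ` X))) \<le> log (real q) (real q ^ k)"
    using assms(1) by (intro log_mono) auto
  then show ?thesis using assms(1) by (simp add: ima_def)
qed

lemma ima_ge:
  assumes "q \<ge> 2" "q ^ k \<le> card (g ` X)"
  shows "real k \<le> ima q X g"
proof -
  have "real q ^ k \<le> real (card (g ` X))"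
    using assms(2) by (metis of_nat_le_iff of_nat_power)
  then have "log (real q) (real q ^ k) \<le> log (real q) (real (card (g ` X)))"
    using assms(1) by (intro log_mono) auto
  then show ?thesis using assms(1) by (simp add: ima_def)
qed

text \<open>The upper bound holds throughout \<open>F_sub D q\<close> and copying networks attain
  it, so any family between the two has the same maximum; this treats \<open>F_sub\<close> and
  \<open>F_exact\<close> together.\<close>

theorem max_ima_eq_alpha:
  fixes D :: "'a pair_pre_digraph"
  assumes D: "pair_wf_digraph D" and fin: "finite (pverts D)" and p: "p \<ge> 1" and q: "q \<ge> 2"
    and F: "F \<subseteq> F_sub D q" "\<And>\<sigma>. \<sigma> permutes pverts D \<Longrightarrow> copy_network D q \<sigma> \<in> F"
  shows "Max {ima q (configs (pverts D) q) (f ^^ p) | f. f \<in> F} = real (alpha p D)"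
proof -
  let ?X = "configs (pverts D) q"
  obtain \<sigma> and A B :: "'a \<Rightarrow> int" where \<sigma>: "\<sigma> permutes pverts D"
    and AB: "\<And>v. v \<in> pverts D \<Longrightarrow> 0 \<le> A v"
      "\<And>v. v \<in> pverts D \<Longrightarrow> B v \<le> int p"
      "\<And>u v. u \<in> pverts D \<Longrightarrow> v \<in> pverts D \<Longrightarrow> (u, v) \<in> parcs D \<Longrightarrow> B u \<le> A v"
    and cut: "card (time_cut (pverts D) p A B) = alpha p D"
    and sources: "card (orbit_sources (parcs D) (pverts D) p \<sigma>) = alpha p D"
    by (rule alpha_duality[OF fin p]) (rule that)
  have X: "?X \<noteq> {}"
    using q by (auto simp: configs_def PiE_eq_empty_iff)
  have upper: "ima q ?X (f ^^ p) \<le> real (alpha p D)" if "f \<in> F" for f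
    using card_image_funpow_le[where A = A and B = B and p = p, OF D fin subsetD[OF F(1) that] AB] cut
    by (intro ima_le[OF q _ finite_configs[OF fin] X]) simp
  have lower: "real (alpha p D) \<le> ima q ?X (copy_network D q \<sigma> ^^ p)"
    using card_image_copy_network_ge[OF D fin q \<sigma>, of p] sources
    by (intro ima_ge[OF q]) simp
  show ?thesis
  proof (rule Max_eqI)
    have "finite F" using F(1) finite_F_sub[OF fin] finite_subset by blast
    then show "finite {ima q ?X (f ^^ p) | f. f \<in> F}" by simp
    show "real (alpha p D) \<in> {ima q ?X (f ^^ p) | f. f \<in> F}"
      using upper[OF F(2)[OF \<sigma>]] lower F(2)[OF \<sigma>] by force
  qed (use upper in auto)
qed

theorem theorem2:
  fixes D :: "nat pair_pre_digraph" and n p :: nat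
  assumes "pair_wf_digraph D"
    and "pverts D = {1..n}"
    and "p \<ge> 1"
  shows "(\<forall>q\<ge>3.
            Max {ima q (configs {1..n} q) (f ^^ p) | f. f \<in> F_exact D q}
              = Max {ima q (configs {1..n} q) (f ^^ p) | f. f \<in> F_sub D q}
          \<and> Max {ima q (configs {1..n} q) (f ^^ p) | f. f \<in> F_sub D q} = real (alpha p D))
       \<and> Max {ima 2 (configs {1..n} 2) (f ^^ p) | f. f \<in> F_sub D 2} = real (alpha p D)"
proof -
  have fin: "finite (pverts D)" using assms(2) by simp
  have sub: "Max {ima q (configs {1..n} q) (f ^^ p) | f. f \<in> F_sub D q} = real (alpha p D)"
    if "q \<ge> 2" for q
    using max_ima_eq_alpha[OF assms(1) fin assms(3) that order_refl]
      copy_network_in_F_sub[OF assms(1) fin that]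
    unfolding assms(2) by blast
  have exact: "Max {ima q (configs {1..n} q) (f ^^ p) | f. f \<in> F_exact D q} = real (alpha p D)"
    if "q \<ge> 3" for q
  proof -
    have q: "q \<ge> 2" using that by simp
    show ?thesis
      using max_ima_eq_alpha[OF assms(1) fin assms(3) q F_exact_subset_F_sub[OF assms(1)]]
        copy_network_in_F_exact[OF assms(1) fin q _ that]
      unfolding assms(2) by blast
  qed
  show ?thesis using sub exact by simp
qed

end
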